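(* Let $0\le \alpha<1$. Let $X_\alpha=C_1^{\alpha}[0,1]$ if $0<\alpha<1$, and $X_0=C[0,1]$ if $\alpha=0$. There exists a dense $G_\delta$ set $\mathcal G\subseteq X_\alpha$ such that if $f\in\mathcal G$, $A\subseteq[0,1]$ and $f|_A$ is monotone, then $\dim_H A\le \underline{\dim}_M A\le \alpha$.
   Context: For $0<\alpha<1$, $C_1^{\alpha}[0,1]$ is the set of functions $f:[0,1]\to\mathbb R$ with $|f(x)-f(y)|\le |x-y|^{\alpha}$ for all $x,y\in[0,1]$, equipped with the sup metric $\|f-g\|_0=\sup_{x\in[0,1]}|f(x)-g(x)|$ (a complete separable metric space). $C[0,1]$ is the space of continuous real functions on $[0,1]$ with the same sup metric. Monotone means (not necessarily strictly) monotone increasing or monotone decreasing. $\dim_H$ denotes Hausdorff dimension. For $A\subseteq[0,1]$ and an integer $k\ge2$ let $\mathcal N_{k,\ell}(A)=\#\{j\in\mathbb Z: A\cap[\frac{j-1}{k^\ell},\frac{j}{k^\ell}]\ne\emptyset\}$. The lower Minkowski (box) dimension is $\underline{\dim}_M A=\liminf_{\ell\to\infty}\frac{\log \mathcal N_{k,\ell}(A)}{\ell\log k}$, which does not depend on $k$. *)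

theory Defs
  imports "HOL-Analysis.Analysis"
begin

(* Elements are extensional functions on [0,1] (value undefined elsewhere), so that equality
   of points of the space is equality of functions on [0,1]; the metric is the sup metric. *)
definition C01 :: "(real \<Rightarrow> real) metric" where
  "C01 = cfunspace (top_of_set {0..1}) euclidean_metric"

definition holder_ball :: "real \<Rightarrow> (real \<Rightarrow> real) metric" where
  "holder_ball \<alpha> =
     submetric C01 {f. \<forall>x\<in>{0..1}. \<forall>y\<in>{0..1}. \<bar>f x - f y\<bar> \<le> \<bar>x - y\<bar> powr \<alpha>}"

definition X_space :: "real \<Rightarrow> (real \<Rightarrow> real) metric" where
  "X_space \<alpha> = (if \<alpha> = 0 then C01 else holder_ball \<alpha>)"

(* The s-th power of the diameter. The case distinction fixes diam(U)^0 = 1 for every nonempty U,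
   singletons included, whereas 0 powr 0 = 0 in the library. *)
definition diam_power :: "real \<Rightarrow> 'a::metric_space set \<Rightarrow> ennreal" where
  "diam_power s U =
     (if U = {} then 0 else if s = 0 then 1 else ennreal (diameter U powr s))"

(* Covers consist of bounded sets, since diameter is unspecified on unbounded ones.
   Finite covers are included by padding with the empty set. *)
definition hausdorff_content :: "real \<Rightarrow> real \<Rightarrow> 'a::metric_space set \<Rightarrow> ennreal" where
  "hausdorff_content s \<delta> A =
     (INF U\<in>{U :: nat \<Rightarrow> 'a set. (\<forall>i. bounded (U i) \<and> diameter (U i) \<le> \<delta>) \<and> A \<subseteq> (\<Union>i. U i)}.
        \<Sum>i. diam_power s (U i))"

definition hausdorff_measure :: "real \<Rightarrow> 'a::metric_space set \<Rightarrow> ennreal" where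
  "hausdorff_measure s A = (SUP \<delta>\<in>{0<..}. hausdorff_content s \<delta> A)"

definition hausdorff_dim :: "'a::metric_space set \<Rightarrow> ereal" where
  "hausdorff_dim A = Inf (ereal ` {s. 0 \<le> s \<and> hausdorff_measure s A = 0})"

definition grid_count :: "nat \<Rightarrow> nat \<Rightarrow> real set \<Rightarrow> nat" where
  "grid_count k l A =
     card {j :: int. A \<inter> {(of_int j - 1) / real k ^ l .. of_int j / real k ^ l} \<noteq> {}}"

(* Intended for bounded sets and k at least 2. As ln 0 = 0, the empty set gets dimension 0,
   as it does for hausdorff_dim. *)
definition lower_minkowski_dim :: "nat \<Rightarrow> real set \<Rightarrow> ereal" where
  "lower_minkowski_dim k A =
     liminf (\<lambda>l. ereal (ln (real (grid_count k l A)) / (real l * ln (real k))))"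

lemma mspace_C01:
  "mspace C01 = {f. f \<in> extensional {0..1} \<and> continuous_on {0..1} f}"
proof -
  have "compactin (top_of_set {0..1::real}) (topspace (top_of_set {0..1}))"
    by (simp add: compactin_subtopology)
  from compactin_mspace_cfunspace[OF this, of "euclidean_metric :: real metric"]
  show ?thesis
    by (auto simp: C01_def)
qed

lemma mdist_C01:
  assumes "f \<in> mspace C01" "g \<in> mspace C01"
  shows "mdist C01 f g = (SUP x\<in>{0..1}. \<bar>f x - g x\<bar>)"
proof -
  have "f \<in> Met_TC.fspace {0..1}" "g \<in> Met_TC.fspace {0..1}"
    using assms cfunspace_subset_funspace[of "top_of_set {0..1}" "euclidean_metric :: real metric"]
    by (auto simp: C01_def)
  then show ?thesis
    by (simp add: C01_def mdist_cfunspace_eq_mdist_funspace Met_TC.fdist_def dist_real_def)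
qed

lemma mspace_holder_ball:
  assumes "0 < \<alpha>"
  shows "mspace (holder_ball \<alpha>) =
    {f. f \<in> extensional {0..1} \<and>
        (\<forall>x\<in>{0..1}. \<forall>y\<in>{0..1}. \<bar>f x - f y\<bar> \<le> \<bar>x - y\<bar> powr \<alpha>)}"
proof -
  have "continuous_on {0..1} f"
    if f: "\<forall>x\<in>{0..1}. \<forall>y\<in>{0..1}. \<bar>f x - f y\<bar> \<le> \<bar>x - y\<bar> powr \<alpha>" for f :: "real \<Rightarrow> real"
    unfolding continuous_on_iff
  proof (intro ballI allI impI)
    fix x e :: real
    assume x: "x \<in> {0..1}" and e: "0 < e"
    have "dist (f y) (f x) < e" if y: "y \<in> {0..1}" "dist y x < e powr (1 / \<alpha>)" for y
    proof -
      have "dist (f y) (f x) \<le> \<bar>y - x\<bar> powr \<alpha>"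
        using f x y by (simp add: dist_real_def)
      also have "\<dots> < (e powr (1 / \<alpha>)) powr \<alpha>"
        using y assms by (intro powr_less_mono2) (auto simp: dist_real_def)
      also have "\<dots> = e"
        using assms e by (simp add: powr_powr)
      finally show ?thesis .
    qed
    then show "\<exists>d>0. \<forall>y\<in>{0..1}. dist y x < d \<longrightarrow> dist (f y) (f x) < e"
      using e by (intro exI[of _ "e powr (1 / \<alpha>)"]) auto
  qed
  then show ?thesis
    by (auto simp: holder_ball_def mspace_C01)
qed

end

theory Submission
  imports Defs "HOL-Real_Asymp.Real_Asymp"
begin

text \<open>
  A set on which a function increases is small wherever the function decreases steeply. Any \<open>f\<close> in
  the space can be perturbed by an arbitrarily small amount into a function that decreases steeply
  everywhere except on very short intervals, on which it climbs back. Let \<open>g\<close> be such a perturbation,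
  with \<open>K\<close> descents and climbs of length \<open>q = k ^ -l\<close>. If \<open>h\<close> is uniformly within \<open>q / 2\<close> of \<open>g\<close> and
  increases on \<open>A\<close>, then \<open>A\<close> meets each descent in a set of diameter at most \<open>q\<close>: going further down
  would cost more than the error can repay. Each climb has length \<open>q\<close> anyway. Hence \<open>A\<close> meets \<open>O(K)\<close>
  grid intervals of length \<open>q\<close>.

  The Hoelder condition decides how large \<open>K\<close> must be. The descents must beat the slope \<open>M\<close> of a
  Lipschitz approximation of \<open>f\<close>, so a climb has to gain a height of order \<open>M / K\<close> over a length \<open>q\<close>.
  A small \<open>\<beta>\<close>-Hoelder constant allows this as soon as \<open>1 / K\<close> is a small multiple of \<open>q powr \<beta>\<close>. So
  \<open>K\<close> is of order \<open>q powr - \<beta>\<close> and the count is \<open>O(k ^ (l * \<beta>))\<close>, which gives the dimension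
  \<open>\<beta>\<close> in the limit. For \<open>\<alpha> > 0\<close> take \<open>\<beta> = \<alpha>\<close>; in the space of all continuous functions \<open>\<beta>\<close> may be any small
  positive number.

  The bound holds on a whole ball around \<open>g\<close>, so for every tolerance, every lower bound on
  \<open>l\<close> and either direction of monotonicity the good functions contain a dense open set, and the Baire category theorem applies to
  the countably many conditions. Increasing and decreasing restrictions have to be separate
  conditions: by the Erdoes-Szekeres theorem, among points chosen one from each of \<open>N\<close> intervals some
  \<open>sqrt N\<close> carry a monotone restriction, so no bound below \<open>sqrt N\<close> holds for both directions at the
  same scale.

  The perturbation is \<open>oscillating_perturbation\<close>, built from \<open>lipschitz_approximation\<close> and
  \<open>sawtooth\<close>; its form in the function space is \<open>dense_monotone_thin_ball\<close>. The inequality between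
  the two dimensions is the usual comparison of covers,
  \<open>hausdorff_dim_le_lower_minkowski_dim\<close>.
\<close>

section \<open>Grid counts and the two dimensions\<close>

lemma finite_grid_cells_hit:
  assumes "A \<subseteq> {0..1}" "2 \<le> k"
  shows "finite {j :: int. A \<inter> {(of_int j - 1) / real k ^ l .. of_int j / real k ^ l} \<noteq> {}}"
proof (rule finite_subset)
  have pos: "real k ^ l > 0" using assms by simp
  show "{j :: int. A \<inter> {(of_int j - 1) / real k ^ l .. of_int j / real k ^ l} \<noteq> {}}
      \<subseteq> {0 .. int (k ^ l) + 1}"
  proof
    fix j :: int
    assume "j \<in> {j. A \<inter> {(of_int j - 1) / real k ^ l .. of_int j / real k ^ l} \<noteq> {}}"
    then obtain x where x: "x \<in> A" "x \<in> {(of_int j - 1) / real k ^ l .. of_int j / real k ^ l}"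
      by blast
    have x01: "0 \<le> x" "x \<le> 1" using x assms by auto
    have "0 \<le> of_int j / real k ^ l" "(of_int j - 1) / real k ^ l \<le> 1"
      using x x01 by auto
    then have "0 \<le> real_of_int j" "real_of_int j - 1 \<le> real k ^ l"
      using pos by (auto simp: field_simps zero_le_divide_iff)
    then have "0 \<le> real_of_int j" "real_of_int j \<le> real_of_int (int (k ^ l) + 1)"
      by auto
    then show "j \<in> {0 .. int (k ^ l) + 1}" by (simp only: of_int_le_iff of_int_0_le_iff) auto
  qed
qed simp

text \<open>
  The grid intervals that meet \<open>A\<close> are one admissible cover, and all of them have the same diameter.
\<close>

lemma hausdorff_content_le_grid_count:
  fixes A :: "real set"
  assumes A: "A \<subseteq> {0..1}" and k: "2 \<le> k" and s: "0 < s" and \<delta>: "1 / real k ^ l \<le> \<delta>"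
  shows "hausdorff_content s \<delta> A
           \<le> ennreal (real (grid_count k l A) * (1 / real k ^ l) powr s)"
proof -
  define cell where "cell = (\<lambda>j :: int. {(of_int j - 1) / real k ^ l .. of_int j / real k ^ l})"
  define J where "J = {j. A \<inter> cell j \<noteq> {}}"
  define N where "N = grid_count k l A"
  have pos: "real k ^ l > 0" using k by simp
  have finJ: "finite J" unfolding J_def cell_def using finite_grid_cells_hit[OF A k] .
  have N: "card J = N" by (simp add: N_def grid_count_def J_def cell_def)
  obtain e where e: "bij_betw e {..<N} J"
    using ex_bij_betw_nat_finite[OF finJ] N by (auto simp: atLeast0LessThan)
  have len: "of_int j / real k ^ l - (of_int j - 1) / real k ^ l = 1 / real k ^ l" for j :: int
    by (simp add: diff_divide_distrib)
  have diam: "diameter (cell j) = 1 / real k ^ l" for j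
    using pos len[of j] unfolding cell_def diameter_closed_interval by (auto simp: field_simps)
  have ne: "cell j \<noteq> {}" for j
    using pos by (auto simp: cell_def field_simps)
  define U where "U = (\<lambda>i. if i < N then cell (e i) else {})"
  have cover: "A \<subseteq> (\<Union>i. U i)"
  proof
    fix x assume x: "x \<in> A"
    define j where "j = \<lceil>x * real k ^ l\<rceil>"
    have "x \<in> cell j"
      using pos unfolding cell_def j_def
      by (simp add: field_simps) linarith
    then have "j \<in> J" using x by (auto simp: J_def)
    then obtain i where "i < N" "e i = j"
      using e by (auto simp: bij_betw_def)
    then show "x \<in> (\<Union>i. U i)"
      using \<open>x \<in> cell j\<close> by (auto simp: U_def)
  qed
  have bd: "bounded (U i) \<and> diameter (U i) \<le> \<delta>" for i
  proof -
    have "bounded (cell j)" for j by (simp add: cell_def)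
    then show ?thesis
      using diam \<delta> pos order_trans[of 0 "1 / real k ^ l" \<delta>] by (auto simp: U_def)
  qed
  have "hausdorff_content s \<delta> A \<le> (\<Sum>i. diam_power s (U i))"
    unfolding hausdorff_content_def using cover bd by (intro INF_lower) auto
  also have "\<dots> = (\<Sum>i<N. diam_power s (U i))"
    by (rule suminf_finite) (auto simp: U_def diam_power_def)
  also have "\<dots> = (\<Sum>i<N. ennreal ((1 / real k ^ l) powr s))"
    using s by (intro sum.cong) (auto simp: U_def diam_power_def ne diam)
  also have "\<dots> = ennreal (real N * (1 / real k ^ l) powr s)"
    by (simp add: ennreal_mult ennreal_of_nat_eq_real_of_nat)
  finally show ?thesis by (simp add: N_def)
qed

text \<open>
  If \<open>s' < s\<close> and infinitely many scales \<open>l\<close> have at most \<open>k ^ (l * s')\<close> grid intervals meeting \<open>A\<close>,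
  then the grid covers of these scales have \<open>s\<close>-dimensional sums at most \<open>k ^ (l * (s' - s))\<close>,
  which tend to \<open>0\<close>. The \<open>s\<close>-dimensional measure therefore vanishes.
\<close>

theorem hausdorff_dim_le_lower_minkowski_dim:
  fixes A :: "real set"
  assumes A: "A \<subseteq> {0..1}" and k: "2 \<le> k"
  shows "hausdorff_dim A \<le> lower_minkowski_dim k A"
proof (rule ccontr)
  define X where "X = (\<lambda>l. ln (real (grid_count k l A)) / (real l * ln (real k)))"
  assume "\<not> ?thesis"
  then have "lower_minkowski_dim k A < hausdorff_dim A" by simp
  then obtain s where s: "lower_minkowski_dim k A < ereal s" "ereal s < hausdorff_dim A"
    using ereal_dense2 by blast
  then obtain s' where s': "lower_minkowski_dim k A < ereal s'" "ereal s' < ereal s"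
    using ereal_dense2 by blast
  have lnk: "ln (real k) > 0" using k by simp
  have X0: "0 \<le> X l" for l
    using lnk by (cases "grid_count k l A") (auto simp: X_def)
  have freq: "\<exists>l\<ge>m. X l < s'" for m
  proof (rule ccontr)
    assume "\<not> ?thesis"
    then have "eventually (\<lambda>l. ereal s' \<le> ereal (X l)) sequentially"
      by (auto simp: eventually_sequentially not_less)
    then have "ereal s' \<le> lower_minkowski_dim k A"
      unfolding lower_minkowski_dim_def X_def by (rule Liminf_bounded)
    then show False using s' by simp
  qed
  \<comment> \<open>Positivity of \<open>s\<close> keeps clear of the convention for zeroth powers of diameters.\<close>
  have s'pos: "s' > 0" using freq[of 0] X0 by (meson le_less_trans)
  have spos: "s > 0" using s' s'pos by simp
  define T where "T = real k"
  have T: "T > 1" using k by (simp add: T_def)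
  have lim: "(\<lambda>l. (T powr (s' - s)) ^ l) \<longlonglongrightarrow> 0"
    using s' T by (intro LIMSEQ_realpow_zero) (auto simp: powr_less_one)
  have lim2: "(\<lambda>l. (1 / T) ^ l) \<longlonglongrightarrow> 0"
    using T by (intro LIMSEQ_realpow_zero) auto
  have "hausdorff_content s \<delta> A \<le> 0" if \<delta>: "\<delta> > 0" for \<delta>
  proof (rule ennreal_le_epsilon)
    fix \<epsilon> :: real assume \<epsilon>: "\<epsilon> > 0"
    have "eventually (\<lambda>l. (T powr (s' - s)) ^ l < \<epsilon> \<and> (1 / T) ^ l < \<delta> \<and> l > 0) sequentially"
      using order_tendstoD(2)[OF lim \<epsilon>] order_tendstoD(2)[OF lim2 \<delta>] eventually_gt_at_top[of 0]
      by eventually_elim auto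
    then obtain m where m: "\<And>l. l \<ge> m \<Longrightarrow>
        (T powr (s' - s)) ^ l < \<epsilon> \<and> (1 / T) ^ l < \<delta> \<and> l > 0"
      by (auto simp: eventually_sequentially)
    obtain l where l: "l \<ge> m" "X l < s'" using freq by blast
    note ml = m[OF l(1)]
    define N where "N = grid_count k l A"
    have NT: "real N \<le> T powr (l * s')"
    proof (cases "N = 0")
      case False
      have "ln (real N) < l * s' * ln T"
        using l ml T by (simp add: X_def N_def T_def field_simps)
      also have "\<dots> = ln (T powr (l * s'))" using T by (simp add: ln_powr)
      finally have "real N < T powr (l * s')" using False T by (subst (asm) ln_less_cancel_iff) auto
      then show ?thesis by simp
    qed simp
    have "hausdorff_content s \<delta> A \<le> ennreal (real N * (1 / T ^ l) powr s)"
      using hausdorff_content_le_grid_count[OF A k spos, of l \<delta>] ml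
      by (simp add: N_def T_def power_one_over)
    also have "real N * (1 / T ^ l) powr s \<le> T powr (l * s') * (1 / T ^ l) powr s"
      using NT by (intro mult_right_mono) auto
    also have "\<dots> = (T powr (s' - s)) ^ l"
      using T by (simp add: powr_realpow[symmetric] powr_powr powr_divide powr_diff
          divide_simps powr_add[symmetric] algebra_simps)
    also have "\<dots> \<le> \<epsilon>" using ml by simp
    finally show "hausdorff_content s \<delta> A \<le> 0 + ennreal \<epsilon>"
      by (simp add: ennreal_leI)
  qed
  then have "hausdorff_measure s A = 0"
    unfolding hausdorff_measure_def by (intro antisym SUP_least) auto
  then have "hausdorff_dim A \<le> ereal s"
    unfolding hausdorff_dim_def using spos by (intro Inf_lower) auto
  then show False using s by simp
qed

lemma lower_minkowski_dim_le:
  assumes k: "2 \<le> k" and \<gamma>: "0 \<le> \<gamma>"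
    and many: "\<And>n m. \<exists>l\<ge>m. real (grid_count k l A) \<le> (real k ^ l) powr (\<gamma> + 1 / real (Suc n))"
  shows "lower_minkowski_dim k A \<le> ereal \<gamma>"
proof (rule ccontr)
  define X where "X = (\<lambda>l. ln (real (grid_count k l A)) / (real l * ln (real k)))"
  assume "\<not> ?thesis"
  then obtain c where c: "ereal \<gamma> < ereal c" "ereal c < lower_minkowski_dim k A"
    using ereal_dense2 by (metis not_le)
  obtain n where n: "1 / real (Suc n) < c - \<gamma>"
    using c reals_Archimedean[of "c - \<gamma>"] by (auto simp: inverse_eq_divide)
  have "\<forall>\<^sub>F l in sequentially. ereal c < ereal (X l)"
    using less_LiminfD[OF c(2)[unfolded lower_minkowski_dim_def]] by (simp add: X_def)
  then obtain m where m: "\<And>l. l \<ge> m \<Longrightarrow> c < X l" by (auto simp: eventually_sequentially)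
  obtain l where l: "l \<ge> Suc m"
    and count: "real (grid_count k l A) \<le> (real k ^ l) powr (\<gamma> + 1 / real (Suc n))"
    using many by blast
  have lnk: "0 < ln (real k)" using k by simp
  have "ln (real (grid_count k l A)) \<le> (\<gamma> + 1 / real (Suc n)) * (real l * ln (real k))"
  proof (cases "grid_count k l A = 0")
    case False
    then have "ln (real (grid_count k l A)) \<le> ln ((real k ^ l) powr (\<gamma> + 1 / real (Suc n)))"
      using count k by (subst ln_le_cancel_iff) auto
    also have "\<dots> = (\<gamma> + 1 / real (Suc n)) * (real l * ln (real k))"
      using k by (simp add: ln_powr ln_realpow)
    finally show ?thesis .
  qed (use \<gamma> lnk in auto)
  then have "X l \<le> \<gamma> + 1 / real (Suc n)"
    using l lnk by (simp add: X_def divide_le_eq)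
  then show False using m[of l] l n by simp
qed

lemma grid_count_le_pieces:
  assumes k: "2 \<le> k" and I: "finite I"
    and cover: "A \<subseteq> (\<Union>i\<in>I. B i)"
    and small: "\<And>i x y. i \<in> I \<Longrightarrow> x \<in> B i \<Longrightarrow> y \<in> B i \<Longrightarrow> \<bar>x - y\<bar> \<le> 1 / real k ^ l"
  shows "grid_count k l A \<le> 4 * card I"
proof -
  define T where "T = real k ^ l"
  have T: "0 < T" using k by (simp add: T_def)
  \<comment> \<open>A grid interval that meets the piece of \<open>z\<close> has a point within \<open>1 / T\<close> of \<open>z\<close>: four candidates.\<close>
  define z where "z = (\<lambda>i. SOME x. x \<in> B i)"
  define J where "J = (\<lambda>i. {\<lfloor>z i * T\<rfloor> - 1 .. \<lfloor>z i * T\<rfloor> + 2})"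
  have sub: "{j :: int. A \<inter> {(of_int j - 1) / T .. of_int j / T} \<noteq> {}} \<subseteq> (\<Union>i\<in>I. J i)"
  proof
    fix j :: int
    assume "j \<in> {j. A \<inter> {(of_int j - 1) / T .. of_int j / T} \<noteq> {}}"
    then obtain x where x: "x \<in> A" "x \<in> {(of_int j - 1) / T .. of_int j / T}"
      by blast
    then obtain i where i: "i \<in> I" "x \<in> B i" using cover by auto
    then have "z i \<in> B i" unfolding z_def by (rule_tac someI)
    then have "\<bar>x - z i\<bar> \<le> 1 / T" using small i unfolding T_def by blast
    then have "\<bar>x - z i\<bar> * T \<le> 1" using T by (simp add: field_simps)
    then have "\<bar>x * T - z i * T\<bar> \<le> 1"
      using T by (simp add: left_diff_distrib[symmetric] abs_mult)
    moreover have "of_int j - 1 \<le> x * T" "x * T \<le> of_int j"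
      using x T by (auto simp: field_simps)
    ultimately have "j \<in> J i" unfolding J_def by (auto; linarith)
    then show "j \<in> (\<Union>i\<in>I. J i)" using i by auto
  qed
  have "grid_count k l A \<le> card (\<Union>i\<in>I. J i)"
    unfolding grid_count_def T_def[symmetric]
    by (rule card_mono[OF _ sub]) (use I in \<open>auto simp: J_def\<close>)
  also have "\<dots> \<le> (\<Sum>i\<in>I. card (J i))" by (rule card_UN_le[OF I])
  also have "\<dots> = 4 * card I" by (simp add: J_def)
  finally show ?thesis .
qed

section \<open>Lipschitz approximation and sawtooth functions\<close>

text \<open>
  Extend \<open>f\<close> to the line by its end values and take the infimal convolution with \<open>M * \<bar>t\<bar>\<close>. The result
  is an infimum of translates of the extension, shifted by constants; hence it inherits every modulus
  of continuity \<open>\<omega>\<close> of \<open>f\<close>, which keeps the approximation inside the Hoelder ball. The extension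
  makes the translates meaningful near the end points of the interval.
\<close>

lemma lipschitz_approximation:
  fixes f :: "real \<Rightarrow> real"
  assumes f: "continuous_on {0..1} f" and \<eta>: "0 < \<eta>"
  obtains g M where "0 \<le> M"
    and "\<And>x y. \<bar>g x - g y\<bar> \<le> M * \<bar>x - y\<bar>"
    and "\<And>x. x \<in> {0..1} \<Longrightarrow> \<bar>g x - f x\<bar> \<le> \<eta>"
    and "\<And>\<omega> x y. mono_on {0..} \<omega> \<Longrightarrow>
           (\<And>u v. u \<in> {0..1} \<Longrightarrow> v \<in> {0..1} \<Longrightarrow> \<bar>f u - f v\<bar> \<le> \<omega> \<bar>u - v\<bar>) \<Longrightarrow>
           \<bar>g x - g y\<bar> \<le> \<omega> \<bar>x - y\<bar>"
proof -
  define r :: "real \<Rightarrow> real" where "r = (\<lambda>x. max 0 (min 1 x))"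
  have r01: "r x \<in> {0..1}" for x by (auto simp: r_def)
  have rfix: "r x = x" if "x \<in> {0..1}" for x using that by (auto simp: r_def)
  have rlip: "\<bar>r x - r y\<bar> \<le> \<bar>x - y\<bar>" for x y by (auto simp: r_def)
  obtain B where B: "\<And>x. x \<in> {0..1} \<Longrightarrow> \<bar>f x\<bar> \<le> B"
    using compact_imp_bounded[OF compact_continuous_image[OF f compact_Icc]]
    unfolding bounded_iff by (metis imageI real_norm_def)
  have B0: "0 \<le> B" using B[of 0] by simp
  obtain d where d: "d > 0"
    "\<And>x y. x \<in> {0..1} \<Longrightarrow> y \<in> {0..1} \<Longrightarrow> \<bar>y - x\<bar> < d \<Longrightarrow> \<bar>f y - f x\<bar> < \<eta>"
    using compact_uniformly_continuous[OF f compact_Icc] \<eta>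
    unfolding uniformly_continuous_on_def dist_real_def by metis
  \<comment> \<open>With this slope a shift by \<open>d\<close> or more costs at least the total oscillation of \<open>f\<close>, so that
    only shifts shorter than \<open>d\<close> can bring \<open>g x\<close> below \<open>f x\<close>.\<close>
  define M where "M = 2 * B / d"
  have M0: "0 \<le> M" using B0 d by (simp add: M_def)
  define G where "G = (\<lambda>x t. f (r (x + t)) + M * \<bar>t\<bar>)"
  define g where "g = (\<lambda>x. INF t. G x t)"
  have bdd: "bdd_below (range (G x))" for x
  proof (rule bdd_belowI2)
    fix t show "- B \<le> G x t"
      using B[OF r01[of "x + t"]] M0 mult_nonneg_nonneg[OF M0 abs_ge_zero[of t]]
      unfolding G_def by linarith
  qed
  have g_le: "g x \<le> G x t" for x t
    unfolding g_def by (rule cINF_lower[OF bdd]) simp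
  have g_ge: "c \<le> g x" if "\<And>t. c \<le> G x t" for c x
    unfolding g_def using that by (intro cINF_greatest) auto
  have close: "\<bar>g x - f x\<bar> \<le> \<eta>" if x: "x \<in> {0..1}" for x
  proof -
    have "g x \<le> f x" using g_le[of x 0] rfix[OF x] by (simp add: G_def)
    moreover have "f x - \<eta> \<le> g x"
    proof (rule g_ge)
      fix t
      show "f x - \<eta> \<le> G x t"
      proof (cases "\<bar>t\<bar> < d")
        case True
        then have "\<bar>r (x + t) - r x\<bar> < d" using rlip[of "x + t" x] by simp
        then have "\<bar>f (r (x + t)) - f x\<bar> < \<eta>"
          using d(2)[OF r01 r01] rfix[OF x] by metis
        then show ?thesis using mult_nonneg_nonneg[OF M0 abs_ge_zero[of t]]
          unfolding G_def by linarith
      next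
        case False
        then have "M * d \<le> M * \<bar>t\<bar>" using M0 by (intro mult_left_mono) auto
        then have "2 * B \<le> M * \<bar>t\<bar>" using d by (simp add: M_def)
        then show ?thesis using B[OF x] B[OF r01[of "x + t"]] \<eta> unfolding G_def by linarith
      qed
    qed
    ultimately show ?thesis using \<eta> by linarith
  qed
  have lip1: "g x - g y \<le> M * \<bar>x - y\<bar>" for x y
  proof -
    have "g x - M * \<bar>x - y\<bar> \<le> g y"
    proof (rule g_ge)
      fix t
      have "g x \<le> G x (y - x + t)" by (rule g_le)
      also have "\<dots> = f (r (y + t)) + M * \<bar>y - x + t\<bar>" by (simp add: G_def)
      also have "M * \<bar>y - x + t\<bar> \<le> M * (\<bar>x - y\<bar> + \<bar>t\<bar>)"
        using M0 by (intro mult_left_mono) auto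
      finally show "g x - M * \<bar>x - y\<bar> \<le> G y t"
        by (simp add: G_def algebra_simps)
    qed
    then show ?thesis by simp
  qed
  have modulus: "\<bar>g x - g y\<bar> \<le> \<omega> \<bar>x - y\<bar>"
    if \<omega>: "mono_on {0..} \<omega>"
      and f\<omega>: "\<And>u v. u \<in> {0..1} \<Longrightarrow> v \<in> {0..1} \<Longrightarrow> \<bar>f u - f v\<bar> \<le> \<omega> \<bar>u - v\<bar>"
    for \<omega> x y
  proof -
    have *: "g x - \<omega> \<bar>x - y\<bar> \<le> g y" for x y
    proof (rule g_ge)
      fix t
      have "\<bar>f (r (x + t)) - f (r (y + t))\<bar> \<le> \<omega> \<bar>r (x + t) - r (y + t)\<bar>"
        by (intro f\<omega> r01)
      also have "\<dots> \<le> \<omega> \<bar>x - y\<bar>"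
        using rlip[of "x + t" "y + t"] by (intro mono_onD[OF \<omega>]) auto
      finally show "g x - \<omega> \<bar>x - y\<bar> \<le> G y t"
        using g_le[of x t] unfolding G_def by linarith
    qed
    show ?thesis using *[of x y] *[of y x] by (auto simp: abs_minus_commute)
  qed
  show ?thesis
  proof (rule that[of M g])
    show "\<bar>g x - g y\<bar> \<le> M * \<bar>x - y\<bar>" for x y
      using lip1[of x y] lip1[of y x] by (auto simp: abs_le_iff abs_minus_commute)
  qed (fact M0 close modulus)+
qed

text \<open>
  The function descends with slope \<open>S\<close> from each of the points \<open>0, p, \<dots>, K * p\<close> and climbs back just
  before the next one, over a length \<open>q\<close>. As a maximum of asymmetric tents it is visibly Lipschitz, with
  the slope of the climbs as constant.
\<close>

lemma sawtooth:
  fixes S p q :: real and K :: nat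
  assumes S: "0 < S" and q: "0 < q" "q \<le> p"
  obtains s :: "real \<Rightarrow> real"
  where "\<And>x. 0 \<le> s x" "\<And>x. s x \<le> S * p"
    and "\<And>x y. \<bar>s x - s y\<bar> \<le> S * p / q * \<bar>x - y\<bar>"
    and "\<And>j x y. j \<le> K \<Longrightarrow> x \<in> {real j * p .. real (Suc j) * p - q} \<Longrightarrow>
           y \<in> {real j * p .. real (Suc j) * p - q} \<Longrightarrow> s y - s x = - S * (y - x)"
proof -
  define H where "H = S * p"
  define L where "L = H / q"
  have p: "0 < p" using q by simp
  have H0: "0 < H" using S p by (simp add: H_def)
  have SL: "S \<le> L" using S q by (simp add: L_def H_def field_simps)
  have L0: "0 < L" using SL S by simp
  \<comment> \<open>Peak \<open>H\<close> at \<open>j * p\<close>, slope \<open>L\<close> to its left and \<open>- S\<close> to its right.\<close>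
  define tent where "tent = (\<lambda>(j :: nat) x. H - max (S * (x - j * p)) (L * (j * p - x)))"
  have tent_le: "tent j x \<le> H" for j x
  proof -
    have "0 \<le> S * (x - j * p) \<or> 0 \<le> L * (j * p - x)"
      using S L0 by (auto simp: zero_le_mult_iff)
    then show ?thesis by (auto simp: tent_def)
  qed
  have tent_lip: "tent j x - tent j y \<le> L * \<bar>x - y\<bar>" for j x y
  proof -
    have "S * (y - j * p) - S * (x - j * p) = S * (y - x)" by (simp add: algebra_simps)
    also have "\<dots> \<le> S * \<bar>x - y\<bar>" using S by (intro mult_left_mono) auto
    also have "\<dots> \<le> L * \<bar>x - y\<bar>" using SL by (intro mult_right_mono) auto
    finally have 1: "S * (y - j * p) - S * (x - j * p) \<le> L * \<bar>x - y\<bar>" .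
    have "L * (j * p - y) - L * (j * p - x) = L * (x - y)" by (simp add: algebra_simps)
    also have "\<dots> \<le> L * \<bar>x - y\<bar>" using L0 by (intro mult_left_mono) auto
    finally have 2: "L * (j * p - y) - L * (j * p - x) \<le> L * \<bar>x - y\<bar>" .
    show ?thesis using 1 2 unfolding tent_def by linarith
  qed
  define V where "V = (\<lambda>x. insert 0 ((\<lambda>j. tent j x) ` {..K}))"
  define s where "s = (\<lambda>x. Max (V x))"
  have fin: "finite (V x)" "V x \<noteq> {}" for x by (auto simp: V_def)
  have s_le: "s x \<le> c" if "0 \<le> c" "\<And>j. j \<le> K \<Longrightarrow> tent j x \<le> c" for x c
    unfolding s_def using that fin by (subst Max_le_iff) (auto simp: V_def)
  have s_ge0: "0 \<le> s x" for x
    unfolding s_def using fin by (intro Max_ge) (auto simp: V_def)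
  have s_ge: "tent j x \<le> s x" if "j \<le> K" for j x
    unfolding s_def using fin that by (intro Max_ge) (auto simp: V_def)
  have s_lip: "s x \<le> s y + L * \<bar>x - y\<bar>" for x y
  proof (rule s_le)
    show "0 \<le> s y + L * \<bar>x - y\<bar>" using s_ge0[of y] L0 by simp
    show "tent j x \<le> s y + L * \<bar>x - y\<bar>" if "j \<le> K" for j
      using tent_lip[of j x y] s_ge[OF that, of y] by simp
  qed
  have s_eq: "s x = H - S * (x - j * p)"
    if j: "j \<le> K" and x: "real j * p \<le> x" "x \<le> real (Suc j) * p - q" for j x
  proof -
    have tj: "tent j x = H - S * (x - j * p)"
    proof -
      have "L * (j * p - x) \<le> 0" "0 \<le> S * (x - j * p)"
        using x L0 S by (auto simp: mult_le_0_iff)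
      then show ?thesis by (simp add: tent_def)
    qed
    have "S * (x - j * p) \<le> S * p"
      using S x q by (intro mult_left_mono) (auto simp: algebra_simps)
    then have tj0: "0 \<le> tent j x" by (simp add: tj H_def)
    \<comment> \<open>The tents on the left are lower by then, those on the right have not yet risen above \<open>0\<close>.\<close>
    have "s x \<le> tent j x"
    proof (rule s_le[OF tj0])
      fix i assume "i \<le> K"
      show "tent i x \<le> tent j x"
      proof (cases "i \<le> j")
        case True
        then have "real i * p \<le> real j * p" using p by (intro mult_right_mono) auto
        then have "S * (x - j * p) \<le> S * (x - i * p)"
          using S by (intro mult_left_mono) auto
        then show ?thesis unfolding tj by (auto simp: tent_def)
      next
        case False
        then have "real (Suc j) * p \<le> real i * p" using p by (intro mult_right_mono) auto
        then have "L * q \<le> L * (i * p - x)"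
          using L0 x by (intro mult_left_mono) auto
        then have "H \<le> L * (i * p - x)" using q by (simp add: L_def)
        then show ?thesis using tj0 by (auto simp: tent_def)
      qed
    qed
    then show ?thesis using s_ge[OF j, of x] tj by simp
  qed
  show ?thesis
  proof (rule that)
    show "0 \<le> s x" for x by (rule s_ge0)
    show "s x \<le> S * p" for x using s_le[of H x] H0 tent_le by (simp add: H_def)
    show "\<bar>s x - s y\<bar> \<le> S * p / q * \<bar>x - y\<bar>" for x y
      using s_lip[of x y] s_lip[of y x] by (auto simp: L_def H_def abs_le_iff abs_minus_commute)
    show "s y - s x = - S * (y - x)"
      if "j \<le> K" "x \<in> {real j * p .. real (Suc j) * p - q}" 
         "y \<in> {real j * p .. real (Suc j) * p - q}" for j x y
      using that s_eq[of j x] s_eq[of j y] by (simp add: algebra_simps)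
  qed
qed

text \<open>
  With \<open>d = \<bar>x - y\<bar> / q\<close> the two bounds together are \<open>H * min 1 d\<close>, and \<open>min 1 d \<le> d powr \<beta>\<close>.
\<close>

lemma bounded_lipschitz_imp_holder:
  fixes u :: "real \<Rightarrow> real"
  assumes q: "0 < q" and \<beta>: "0 < \<beta>" "\<beta> \<le> 1" and H: "0 \<le> H"
    and osc: "\<bar>u x - u y\<bar> \<le> H" and lip: "\<bar>u x - u y\<bar> \<le> H / q * \<bar>x - y\<bar>"
  shows "\<bar>u x - u y\<bar> \<le> H / q powr \<beta> * \<bar>x - y\<bar> powr \<beta>"
proof (cases "x = y")
  case False
  define d where "d = \<bar>x - y\<bar> / q"
  have d: "0 < d" using False q by (simp add: d_def)
  have "\<bar>u x - u y\<bar> \<le> H * d powr \<beta>"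
  proof (cases "d \<le> 1")
    case True
    then have "d powr 1 \<le> d powr \<beta>" using \<beta> d by (intro powr_mono') auto
    then have "H * d \<le> H * d powr \<beta>" using H d by (intro mult_left_mono) auto
    then show ?thesis using lip by (simp add: d_def)
  next
    case False
    then have "1 \<le> d powr \<beta>" using \<beta> by (simp add: ge_one_powr_ge_zero)
    then have "H * 1 \<le> H * d powr \<beta>" using H by (intro mult_left_mono) auto
    then show ?thesis using osc by simp
  qed
  then show ?thesis using q by (simp add: d_def powr_divide)
qed simp

section \<open>The oscillating perturbation\<close>

text \<open>
  The three requirements on the grid frequency \<open>T\<close>, where \<open>C * T powr \<beta>\<close> is the approximate number of
  teeth: a period must be at least as long as a climb, of length \<open>1 / T\<close>, the teeth must be low, and the
  resulting count of grid intervals must be below the target.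
\<close>

lemma eventually_scale_admissible:
  fixes C c \<eta> \<beta> \<epsilon> :: real
  assumes "0 < C" "0 < c" "0 < \<eta>" "0 < \<beta>" "\<beta> < 1" "0 < \<epsilon>"
  shows "\<forall>\<^sub>F T in at_top. C * T powr \<beta> + 1 \<le> T \<and> c * T powr (- \<beta>) \<le> \<eta> \<and>
           8 * (C * T powr \<beta> + 2) \<le> T powr (\<beta> + \<epsilon>)"
proof (intro eventually_conj)
  show "\<forall>\<^sub>F T in at_top. C * T powr \<beta> + 1 \<le> T" using assms by real_asymp
  have "((\<lambda>T. c * T powr (- \<beta>)) \<longlongrightarrow> 0) at_top" using assms by real_asymp
  then show "\<forall>\<^sub>F T in at_top. c * T powr (- \<beta>) \<le> \<eta>"
    using order_tendstoD(2)[of "\<lambda>T. c * T powr (- \<beta>)" 0 at_top \<eta>] assms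
    by (auto elim: eventually_mono)
  show "\<forall>\<^sub>F T in at_top. 8 * (C * T powr \<beta> + 2) \<le> T powr (\<beta> + \<epsilon>)" using assms by real_asymp
qed

text \<open>
  The perturbed function is the sum of a Lipschitz approximation \<open>g0\<close> of \<open>(1 - \<theta>) * f\<close> and a sawtooth
  \<open>s\<close>. Shrinking \<open>f\<close> frees the Hoelder constant \<open>\<theta>\<close> for the sawtooth. The slope \<open>S = M + 1\<close> leaves a
  net descent of slope at least \<open>1\<close> after adding \<open>g0\<close>.
\<close>

lemma oscillating_perturbation:
  fixes f :: "real \<Rightarrow> real" and m :: nat
  assumes f: "continuous_on {0..1} f" and k: "2 \<le> k"
    and \<beta>: "0 < \<beta>" "\<beta> < 1" and \<epsilon>: "0 < \<epsilon>" and \<eta>: "0 < \<eta>"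
  obtains g l \<delta> where "m \<le> l" "0 < \<delta>" "continuous_on {0..1} g"
    and "\<And>x. x \<in> {0..1} \<Longrightarrow> \<bar>g x - f x\<bar> \<le> \<eta>"
    and "(\<forall>x\<in>{0..1}. \<forall>y\<in>{0..1}. \<bar>f x - f y\<bar> \<le> \<bar>x - y\<bar> powr \<beta>) \<longrightarrow>
         (\<forall>x\<in>{0..1}. \<forall>y\<in>{0..1}. \<bar>g x - g y\<bar> \<le> \<bar>x - y\<bar> powr \<beta>)"
    and "\<And>h A. \<forall>x\<in>{0..1}. \<bar>h x - g x\<bar> \<le> \<delta> \<Longrightarrow> A \<subseteq> {0..1} \<Longrightarrow> mono_on A h \<Longrightarrow>
           real (grid_count k l A) \<le> (real k ^ l) powr (\<beta> + \<epsilon>)"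
proof -
  obtain B where B: "\<And>x. x \<in> {0..1} \<Longrightarrow> \<bar>f x\<bar> \<le> B"
    using compact_imp_bounded[OF compact_continuous_image[OF f compact_Icc]]
    unfolding bounded_iff by (metis imageI real_norm_def)
  have B0: "0 \<le> B" using B[of 0] by simp
  define \<theta> where "\<theta> = min (1/2) (\<eta> / (3 * (B + 1)))"
  have \<theta>: "0 < \<theta>" "\<theta> < 1" using \<eta> B0 by (auto simp: \<theta>_def)
  have "\<theta> * B \<le> \<eta> / (3 * (B + 1)) * (B + 1)"
    using B0 \<eta> \<theta> unfolding \<theta>_def by (intro mult_mono) auto
  also have "\<dots> = \<eta> / 3" using B0 by (simp add: divide_simps)
  finally have \<theta>B: "\<theta> * B \<le> \<eta> / 3" .
  define F where "F = (\<lambda>x. (1 - \<theta>) * f x)"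
  have "continuous_on {0..1} F" unfolding F_def by (intro continuous_intros f)
  from lipschitz_approximation[OF this, of "\<eta> / 3"] \<eta>
  obtain g0 M where M: "0 \<le> M"
    and g0_lip: "\<And>x y. \<bar>g0 x - g0 y\<bar> \<le> M * \<bar>x - y\<bar>"
    and g0_close: "\<And>x. x \<in> {0..1} \<Longrightarrow> \<bar>g0 x - F x\<bar> \<le> \<eta> / 3"
    and g0_modulus: "\<And>\<omega> x y. mono_on {0..} \<omega> \<Longrightarrow>
           (\<And>u v. u \<in> {0..1} \<Longrightarrow> v \<in> {0..1} \<Longrightarrow> \<bar>F u - F v\<bar> \<le> \<omega> \<bar>u - v\<bar>) \<Longrightarrow>
           \<bar>g0 x - g0 y\<bar> \<le> \<omega> \<bar>x - y\<bar>"
    by (metis divide_pos_pos zero_less_numeral)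
  define S where "S = M + 1"
  have S: "0 < S" using M by (simp add: S_def)
  define C where "C = S / \<theta>"
  have C: "0 < C" using S \<theta> by (simp add: C_def)
  have "filterlim (\<lambda>l. real k ^ l) at_top sequentially"
    using k by (intro filterlim_at_infinity_imp_filterlim_at_top[OF filterlim_realpow_sequentially_gt1]) auto
  from eventually_compose_filterlim[OF eventually_scale_admissible[OF C \<theta>(1) _ \<beta> \<epsilon>, of "\<eta> / 3"] this] \<eta>
  have "\<forall>\<^sub>F l in sequentially. C * (real k ^ l) powr \<beta> + 1 \<le> real k ^ l \<and>
      \<theta> * (real k ^ l) powr (- \<beta>) \<le> \<eta> / 3 \<and>
      8 * (C * (real k ^ l) powr \<beta> + 2) \<le> (real k ^ l) powr (\<beta> + \<epsilon>)" by simp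
  then obtain l where l: "m \<le> l" and
    l1: "C * (real k ^ l) powr \<beta> + 1 \<le> real k ^ l" and
    l2: "\<theta> * (real k ^ l) powr (- \<beta>) \<le> \<eta> / 3" and
    l3: "8 * (C * (real k ^ l) powr \<beta> + 2) \<le> (real k ^ l) powr (\<beta> + \<epsilon>)"
    by (auto simp: eventually_sequentially) (meson linear)
  define T where "T = real k ^ l"
  have T: "0 < T" using k by (simp add: T_def)
  \<comment> \<open>The least number of teeth for which their height \<open>S / K\<close> is at most \<open>\<theta> * q powr \<beta>\<close>.\<close>
  define K where "K = nat \<lceil>C * T powr \<beta>\<rceil>"
  define p where "p = 1 / real K"
  define q where "q = 1 / T"
  have CT: "0 < C * T powr \<beta>" using C T by simp
  have K: "C * T powr \<beta> \<le> real K" "real K \<le> C * T powr \<beta> + 1"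
    unfolding K_def using CT by linarith+
  have K0: "0 < real K" using CT K by linarith
  have p0: "0 < p" using K0 by (simp add: p_def)
  have q0: "0 < q" using T by (simp add: q_def)
  have "real K \<le> T" using K l1 unfolding T_def by linarith
  then have qp: "q \<le> p" using K0 T by (simp add: q_def p_def field_simps)
  have Hq: "S * p \<le> \<theta> * q powr \<beta>"
  proof -
    have "S * T powr \<beta> \<le> \<theta> * real K" using K(1) \<theta> by (simp add: C_def field_simps)
    then show ?thesis using K0 T by (simp add: p_def q_def powr_divide field_simps)
  qed
  have "q powr \<beta> = T powr (- \<beta>)"
    using T by (simp add: q_def powr_divide powr_minus_divide)
  then have H\<eta>: "S * p \<le> \<eta> / 3" using Hq l2 by (simp add: T_def)
  obtain s :: "real \<Rightarrow> real" where s0: "\<And>x. 0 \<le> s x" and sH: "\<And>x. s x \<le> S * p"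
    and s_lip: "\<And>x y. \<bar>s x - s y\<bar> \<le> S * p / q * \<bar>x - y\<bar>"
    and s_down: "\<And>j x y. j \<le> K \<Longrightarrow> x \<in> {real j * p .. real (Suc j) * p - q} \<Longrightarrow>
           y \<in> {real j * p .. real (Suc j) * p - q} \<Longrightarrow> s y - s x = - S * (y - x)"
    using sawtooth[OF S q0 qp, of K] by blast
  have s_holder: "\<bar>s x - s y\<bar> \<le> \<theta> * \<bar>x - y\<bar> powr \<beta>" for x y
  proof -
    have "\<bar>s x - s y\<bar> \<le> S * p / q powr \<beta> * \<bar>x - y\<bar> powr \<beta>"
      using s0[of x] s0[of y] sH[of x] sH[of y] s_lip[of x y] S p0 \<beta>
      by (intro bounded_lipschitz_imp_holder[OF q0]) auto
    also have "\<dots> \<le> \<theta> * \<bar>x - y\<bar> powr \<beta>"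
      using Hq q0 by (intro mult_right_mono) (auto simp: field_simps)
    finally show ?thesis .
  qed
  define g where "g = (\<lambda>x. g0 x + s x)"
  have g_lip: "\<bar>g x - g y\<bar> \<le> (M + S * p / q) * \<bar>x - y\<bar>" for x y
    using g0_lip[of x y] s_lip[of x y] by (simp add: g_def algebra_simps)
  show ?thesis
  proof (rule that[OF l])
    show "0 < q / 2" using q0 by simp
    have "(M + S * p / q)-lipschitz_on {0..1} g"
      using g_lip M S p0 q0 by (intro lipschitz_onI) (auto simp: dist_real_def)
    then show "continuous_on {0..1} g" by (rule lipschitz_on_continuous_on)
    show "\<bar>g x - f x\<bar> \<le> \<eta>" if x: "x \<in> {0..1}" for x
    proof -
      have "\<bar>\<theta> * f x\<bar> \<le> \<theta> * B" using B[OF x] \<theta> by (simp add: abs_mult)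
      then have "\<bar>F x - f x\<bar> \<le> \<eta> / 3" using \<theta>B by (simp add: F_def algebra_simps)
      then show ?thesis
        using g0_close[OF x] s0[of x] sH[of x] H\<eta> unfolding g_def by linarith
    qed
    show "(\<forall>x\<in>{0..1}. \<forall>y\<in>{0..1}. \<bar>f x - f y\<bar> \<le> \<bar>x - y\<bar> powr \<beta>) \<longrightarrow>
      (\<forall>x\<in>{0..1}. \<forall>y\<in>{0..1}. \<bar>g x - g y\<bar> \<le> \<bar>x - y\<bar> powr \<beta>)"
    proof (intro impI ballI)
      fix x y :: real
      assume f\<beta>: "\<forall>x\<in>{0..1}. \<forall>y\<in>{0..1}. \<bar>f x - f y\<bar> \<le> \<bar>x - y\<bar> powr \<beta>"
      have "\<bar>g0 x - g0 y\<bar> \<le> (\<lambda>d. (1 - \<theta>) * d powr \<beta>) \<bar>x - y\<bar>"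
      proof (rule g0_modulus)
        show "mono_on {0..} (\<lambda>d. (1 - \<theta>) * d powr \<beta>)"
          using \<theta> \<beta> by (intro mono_onI mult_left_mono powr_mono2) auto
        fix u v :: real assume uv: "u \<in> {0..1}" "v \<in> {0..1}"
        have "\<bar>F u - F v\<bar> = (1 - \<theta>) * \<bar>f u - f v\<bar>"
          using \<theta> by (simp add: F_def right_diff_distrib[symmetric] abs_mult)
        also have "\<dots> \<le> (1 - \<theta>) * \<bar>u - v\<bar> powr \<beta>"
          using f\<beta> uv \<theta> by (intro mult_left_mono) auto
        finally show "\<bar>F u - F v\<bar> \<le> (1 - \<theta>) * \<bar>u - v\<bar> powr \<beta>" .
      qed
      then have "\<bar>g0 x - g0 y\<bar> + \<theta> * \<bar>x - y\<bar> powr \<beta> \<le> \<bar>x - y\<bar> powr \<beta>"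
        by (simp add: algebra_simps)
      then show "\<bar>g x - g y\<bar> \<le> \<bar>x - y\<bar> powr \<beta>"
        using s_holder[of x y] unfolding g_def by linarith
    qed
    fix h :: "real \<Rightarrow> real" and A
    assume h: "\<forall>x\<in>{0..1}. \<bar>h x - g x\<bar> \<le> q / 2" and A: "A \<subseteq> {0..1}" and mono: "mono_on A h"
    define down where "down = (\<lambda>j. {real j * p .. real (Suc j) * p - q})"
    define up where "up = (\<lambda>j. {real (Suc j) * p - q .. real (Suc j) * p})"
    have down_le: "y - x \<le> q" if j: "j \<le> K" and x: "x \<in> A \<inter> down j" and y: "y \<in> A \<inter> down j"
      and xy: "x \<le> y" for j x y
    proof -
      have "h x \<le> h y" using mono x y xy by (auto intro: mono_onD)
      moreover have "\<bar>h x - g x\<bar> \<le> q / 2" "\<bar>h y - g y\<bar> \<le> q / 2"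
        using h x y A by blast+
      ultimately have "g x \<le> g y + q" by linarith
      moreover have "s y - s x = - S * (y - x)"
        using x y by (intro s_down[OF j]) (auto simp: down_def)
      moreover have "\<bar>g0 x - g0 y\<bar> \<le> M * (y - x)"
        using g0_lip[of x y] xy by (simp add: abs_minus_commute)
      ultimately show ?thesis by (simp add: g_def S_def algebra_simps)
    qed
    \<comment> \<open>The index \<open>K\<close> is included for the right end point \<open>1 = K * p\<close>.\<close>
    define I where "I = {..K} \<times> (UNIV :: bool set)"
    have "grid_count k l A \<le> 4 * card I"
    proof (rule grid_count_le_pieces[OF k])
      show "finite I" by (simp add: I_def)
      show "A \<subseteq> (\<Union>i\<in>I. case i of (j, b) \<Rightarrow> A \<inter> (if b then down j else up j))"
      proof
        fix x assume x: "x \<in> A"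
        define j where "j = nat \<lfloor>x * K\<rfloor>"
        have x01: "0 \<le> x" "x \<le> 1" using x A by auto
        have xK: "x * K \<le> K" using x01 K0 mult_right_mono[of x 1 "real K"] by simp
        have jx: "real j \<le> x * K" "x * K \<le> real (Suc j)"
          unfolding j_def using x01 by (auto simp: mult_nonneg_nonneg) linarith
        have "j \<le> K" using jx(1) xK by linarith
        moreover have "real j * p \<le> x" "x \<le> real (Suc j) * p"
          using jx K0 by (auto simp: p_def field_simps)
        then have "x \<in> (case (j, x \<in> down j) of (j, b) \<Rightarrow> A \<inter> (if b then down j else up j))"
          using x by (auto simp: down_def up_def)
        ultimately show "x \<in> (\<Union>i\<in>I. case i of (j, b) \<Rightarrow> A \<inter> (if b then down j else up j))"
          by (intro UN_I[of "(j, x \<in> down j)"]) (auto simp: I_def)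
      qed
      fix i x y
      assume "i \<in> I" "x \<in> (case i of (j, b) \<Rightarrow> A \<inter> (if b then down j else up j))"
        "y \<in> (case i of (j, b) \<Rightarrow> A \<inter> (if b then down j else up j))"
      then obtain j where "j \<le> K"
        "x \<in> A \<inter> down j \<and> y \<in> A \<inter> down j \<or> x \<in> up j \<and> y \<in> up j"
        by (cases i) (auto simp: I_def split: if_splits)
      then have "\<bar>x - y\<bar> \<le> q"
        using down_le[of j x y] down_le[of j y x] by (auto simp: up_def abs_le_iff; linarith)
      then show "\<bar>x - y\<bar> \<le> 1 / real k ^ l" by (simp add: q_def T_def)
    qed
    also have "4 * card I = 8 * (K + 1)" by (simp add: I_def card_cartesian_product)
    finally have "real (grid_count k l A) \<le> real (8 * (K + 1))" by (rule of_nat_mono)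
    also have "\<dots> = 8 * (real K + 1)" by simp
    also have "\<dots> \<le> 8 * (C * T powr \<beta> + 2)" using K(2) by simp
    also have "\<dots> \<le> T powr (\<beta> + \<epsilon>)" using l3 by (simp add: T_def)
    finally show "real (grid_count k l A) \<le> (real k ^ l) powr (\<beta> + \<epsilon>)" by (simp add: T_def)
  qed
qed

section \<open>The function spaces\<close>

lemma mspace_X_space:
  "f \<in> mspace (X_space \<alpha>) \<longleftrightarrow>
    f \<in> extensional {0..1} \<and> continuous_on {0..1} f \<and>
    (\<alpha> \<noteq> 0 \<longrightarrow> (\<forall>x\<in>{0..1}. \<forall>y\<in>{0..1}. \<bar>f x - f y\<bar> \<le> \<bar>x - y\<bar> powr \<alpha>))"
  by (auto simp: X_space_def holder_ball_def mspace_C01)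

lemma mspace_X_space_subset: "mspace (X_space \<alpha>) \<subseteq> mspace C01"
  by (auto simp: X_space_def holder_ball_def)

lemma mdist_X_space_le_iff:
  assumes "f \<in> mspace (X_space \<alpha>)" "g \<in> mspace (X_space \<alpha>)"
  shows "mdist (X_space \<alpha>) f g \<le> c \<longleftrightarrow> (\<forall>x\<in>{0..1}. \<bar>f x - g x\<bar> \<le> c)"
proof -
  have "mdist (X_space \<alpha>) = mdist C01" by (simp add: X_space_def holder_ball_def)
  moreover have "f \<in> mspace C01" "g \<in> mspace C01"
    using assms mspace_X_space_subset by auto
  then have "mdist C01 f g \<le> c \<longleftrightarrow> (\<forall>x\<in>{0..1}. \<bar>f x - g x\<bar> \<le> c)"
    unfolding C01_def by (subst cfunspace_mdist_le) (auto simp: dist_real_def)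
  ultimately show ?thesis by simp
qed

lemma mcomplete_C01: "Metric_space.mcomplete (mspace C01) (mdist C01)"
proof -
  have "Met_TC.mcomplete TYPE(real)"
    using complete_UNIV by (simp add: mcomplete_iff_complete)
  from Met_TC.mcomplete_cfunspace[OF this, of "top_of_set {0..1::real}"] 
  show ?thesis
    by (simp add: mcomplete_of_def C01_def euclidean_metric_def Met_TC.Self_def)
qed

text \<open>
  Uniform limits are pointwise limits, and each of the defining inequalities involves two points only.
\<close>

lemma closedin_holder_ball:
  "closedin (mtopology_of C01)
     {f \<in> mspace C01. \<forall>x\<in>{0..1}. \<forall>y\<in>{0..1}. \<bar>f x - f y\<bar> \<le> \<bar>x - y\<bar> powr \<alpha>}"
    (is "closedin _ ?S")
proof -
  interpret C: Metric_space "mspace C01" "mdist C01" by (rule Metric_space_mspace_mdist)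
  have eval: "mdist C01 f g \<le> c \<longleftrightarrow> (\<forall>x\<in>{0..1}. \<bar>f x - g x\<bar> \<le> c)"
    if "f \<in> mspace C01" "g \<in> mspace C01" for f g c
    using mdist_X_space_le_iff[of f 0 g c] that by (simp add: X_space_def)
  show ?thesis
    unfolding mtopology_of_def C.metric_closedin_iff_sequentially_closed
  proof (intro conjI allI impI)
    fix \<sigma> f assume "range \<sigma> \<subseteq> ?S \<and> limitin C.mtopology \<sigma> f sequentially"
    then have \<sigma>: "\<And>n. \<sigma> n \<in> ?S" and f: "f \<in> mspace C01"
      and lim: "(\<lambda>n. mdist C01 (\<sigma> n) f) \<longlonglongrightarrow> 0"
      by (auto simp: C.limitin_metric_dist_null)
    have pw: "(\<lambda>n. \<sigma> n x) \<longlonglongrightarrow> f x" if x: "x \<in> {0..1}" for x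
    proof (rule LIM_zero_cancel, rule Lim_null_comparison[OF _ lim])
      show "\<forall>\<^sub>F n in sequentially. norm (\<sigma> n x - f x) \<le> mdist C01 (\<sigma> n) f"
        using eval[of "\<sigma> n" f "mdist C01 (\<sigma> n) f" for n] \<sigma> f x by (auto intro!: always_eventually)
    qed
    have "\<bar>f x - f y\<bar> \<le> \<bar>x - y\<bar> powr \<alpha>" if "x \<in> {0..1}" "y \<in> {0..1}" for x y
      by (rule LIMSEQ_le_const2[OF tendsto_rabs[OF tendsto_diff[OF pw[OF that(1)] pw[OF that(2)]]]])
         (use \<sigma> that in auto)
    then show "f \<in> ?S" using f by auto
  qed auto
qed

text \<open>
  The Baire category theorem needs completeness; the Hoelder ball is a closed subset of the complete
  space of continuous functions.
\<close>

lemma mcomplete_X_space: "Metric_space.mcomplete (mspace (X_space \<alpha>)) (mdist (X_space \<alpha>))"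
proof (cases "\<alpha> = 0")
  case True
  then show ?thesis by (simp add: X_space_def mcomplete_C01)
next
  case False
  define S where "S = mspace (holder_ball \<alpha>)"
  have S: "S = {f \<in> mspace C01. \<forall>x\<in>{0..1}. \<forall>y\<in>{0..1}. \<bar>f x - f y\<bar> \<le> \<bar>x - y\<bar> powr \<alpha>}"
    by (auto simp: S_def holder_ball_def)
  interpret C: Submetric "mspace C01" "mdist C01" S
    by (intro Submetric.intro Submetric_axioms.intro Metric_space_mspace_mdist) (auto simp: S)
  have "C.sub.mcomplete"
    using C.closedin_mcomplete_imp_mcomplete closedin_holder_ball[of \<alpha>] mcomplete_C01
    unfolding S[symmetric] mtopology_of_def by blast
  then show ?thesis using False by (simp add: X_space_def S_def) (simp add: holder_ball_def)
qed

section \<open>Generic functions\<close>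

text \<open>
  The sign \<open>\<sigma>\<close>, which is \<open>1\<close> or \<open>-1\<close>, selects increasing or decreasing restrictions. The single scale
  \<open>l\<close> serves all sets \<open>A\<close> at once, so that a condition on \<open>h\<close> alone results, one that can hold on a ball.
\<close>

definition monotone_thin :: "real \<Rightarrow> real \<Rightarrow> real \<Rightarrow> nat \<Rightarrow> nat \<Rightarrow> (real \<Rightarrow> real) \<Rightarrow> bool" where
  "monotone_thin \<sigma> \<gamma> \<epsilon> k m h \<longleftrightarrow>
     (\<exists>l\<ge>m. \<forall>A\<subseteq>{0..1}. mono_on A (\<lambda>x. \<sigma> * h x) \<longrightarrow>
        real (grid_count k l A) \<le> (real k ^ l) powr (\<gamma> + \<epsilon>))"

text \<open>
  This transfers \<open>oscillating_perturbation\<close> to the function space; decreasing restrictions of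
  \<open>f\<close> are increasing restrictions of \<open>- f\<close>.
\<close>

lemma dense_monotone_thin_ball:
  assumes \<alpha>: "0 \<le> \<alpha>" "\<alpha> < 1" and k: "2 \<le> k" and \<epsilon>: "0 < \<epsilon>" and \<eta>: "0 < \<eta>"
    and \<sigma>: "\<sigma> \<in> {1, -1}" and f: "f \<in> mspace (X_space \<alpha>)"
  obtains g \<delta> where "g \<in> mspace (X_space \<alpha>)" "mdist (X_space \<alpha>) f g \<le> \<eta>" "0 < \<delta>"
    "\<And>h. h \<in> mspace (X_space \<alpha>) \<Longrightarrow> mdist (X_space \<alpha>) g h < \<delta> \<Longrightarrow> monotone_thin \<sigma> \<alpha> \<epsilon> k m h"
proof -
  note f' = f[unfolded mspace_X_space]
  have \<sigma>1: "\<sigma> * \<sigma> = 1" "\<bar>\<sigma>\<bar> = 1" using \<sigma> by auto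
  have \<sigma>abs: "\<bar>\<sigma> * a - \<sigma> * b\<bar> = \<bar>a - b\<bar>" for a b
    by (simp add: right_diff_distrib[symmetric] abs_mult \<sigma>1)
  \<comment> \<open>For \<open>\<alpha> = 0\<close> there is no Hoelder condition to preserve, and half of the tolerance goes into \<open>\<beta>\<close>.\<close>
  define \<beta> where "\<beta> = (if \<alpha> = 0 then min (1/2) (\<epsilon> / 2) else \<alpha>)"
  have \<beta>: "0 < \<beta>" "\<beta> < 1" "\<beta> + \<epsilon> / 2 \<le> \<alpha> + \<epsilon>"
    using \<alpha> \<epsilon> by (auto simp: \<beta>_def)
  have \<epsilon>2: "0 < \<epsilon> / 2" using \<epsilon> by simp
  have cont: "continuous_on {0..1} (\<lambda>x. \<sigma> * f x)"
    using f' by (intro continuous_intros) auto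
  obtain g0 l \<delta> where l: "m \<le> l" and \<delta>: "0 < \<delta>" and g0_cont: "continuous_on {0..1} g0"
    and close: "\<And>x. x \<in> {0..1} \<Longrightarrow> \<bar>g0 x - \<sigma> * f x\<bar> \<le> \<eta>"
    and holder: "(\<forall>x\<in>{0..1}. \<forall>y\<in>{0..1}. \<bar>\<sigma> * f x - \<sigma> * f y\<bar> \<le> \<bar>x - y\<bar> powr \<beta>) \<longrightarrow>
         (\<forall>x\<in>{0..1}. \<forall>y\<in>{0..1}. \<bar>g0 x - g0 y\<bar> \<le> \<bar>x - y\<bar> powr \<beta>)"
    and thin: "\<And>h A. \<forall>x\<in>{0..1}. \<bar>h x - g0 x\<bar> \<le> \<delta> \<Longrightarrow> A \<subseteq> {0..1} \<Longrightarrow> mono_on A h \<Longrightarrow>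
           real (grid_count k l A) \<le> (real k ^ l) powr (\<beta> + \<epsilon> / 2)"
    by (rule oscillating_perturbation[OF cont k \<beta>(1,2) \<epsilon>2 \<eta>, of m]) blast
  define g where "g = restrict (\<lambda>x. \<sigma> * g0 x) {0..1}"
  have g_eq: "g x = \<sigma> * g0 x" if "x \<in> {0..1}" for x using that by (simp add: g_def)
  have gX: "g \<in> mspace (X_space \<alpha>)"
    unfolding mspace_X_space
  proof (intro conjI impI ballI)
    show "g \<in> extensional {0..1}" by (simp add: g_def)
    show "continuous_on {0..1} g"
      using continuous_on_mult_left[OF g0_cont, of \<sigma>]
      by (rule continuous_on_eq) (simp add: g_eq)
    fix x y :: real assume "\<alpha> \<noteq> 0" and xy: "x \<in> {0..1}" "y \<in> {0..1}"
    then have "\<bar>g0 x - g0 y\<bar> \<le> \<bar>x - y\<bar> powr \<alpha>"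
      using holder f' by (simp add: \<beta>_def \<sigma>abs)
    then show "\<bar>g x - g y\<bar> \<le> \<bar>x - y\<bar> powr \<alpha>"
      unfolding g_eq[OF xy(1)] g_eq[OF xy(2)] \<sigma>abs .
  qed
  have \<sigma>g: "\<sigma> * (g x) = g0 x" if "x \<in> {0..1}" for x
    using \<sigma>1 by (simp add: g_eq[OF that] mult.assoc[symmetric])
  show ?thesis
  proof (rule that[OF gX _ \<delta>])
    show "mdist (X_space \<alpha>) f g \<le> \<eta>"
      unfolding mdist_X_space_le_iff[OF f gX]
    proof
      fix x :: real assume x: "x \<in> {0..1}"
      have "\<bar>f x - g x\<bar> = \<bar>\<sigma> * f x - \<sigma> * g x\<bar>" by (simp add: \<sigma>abs)
      also have "\<dots> \<le> \<eta>" using close[OF x] by (simp add: \<sigma>g[OF x] abs_minus_commute)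
      finally show "\<bar>f x - g x\<bar> \<le> \<eta>" .
    qed
    fix h assume h: "h \<in> mspace (X_space \<alpha>)" "mdist (X_space \<alpha>) g h < \<delta>"
    have near: "\<forall>x\<in>{0..1}. \<bar>\<sigma> * h x - g0 x\<bar> \<le> \<delta>"
    proof
      fix x :: real assume x: "x \<in> {0..1}"
      have "mdist (X_space \<alpha>) g h \<le> \<delta>" using h by simp
      then have "\<bar>g x - h x\<bar> \<le> \<delta>" using mdist_X_space_le_iff[OF gX h(1)] x by blast
      then show "\<bar>\<sigma> * h x - g0 x\<bar> \<le> \<delta>"
        using \<sigma>abs[of "h x" "g x"] by (simp add: \<sigma>g[OF x] abs_minus_commute)
    qed
    have "(real k ^ l) powr (\<beta> + \<epsilon> / 2) \<le> (real k ^ l) powr (\<alpha> + \<epsilon>)"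
      using k \<beta> by (intro powr_mono) auto
    then show "monotone_thin \<sigma> \<alpha> \<epsilon> k m h"
      unfolding monotone_thin_def using l thin[OF near] order_trans by blast
  qed
qed

theorem theorem2:
  fixes \<alpha> :: real
  assumes "0 \<le> \<alpha>" and "\<alpha> < 1"
  shows "\<exists>\<G>. gdelta_in (mtopology_of (X_space \<alpha>)) \<G> \<and>
           mtopology_of (X_space \<alpha>) closure_of \<G> = mspace (X_space \<alpha>) \<and>
           (\<forall>f\<in>\<G>. \<forall>A\<subseteq>{0..1}. mono_on A f \<or> antimono_on A f \<longrightarrow>
              (\<forall>k\<ge>2. hausdorff_dim A \<le> lower_minkowski_dim k A \<and>
                      lower_minkowski_dim k A \<le> ereal \<alpha>))"
proof -
  interpret X: Metric_space "mspace (X_space \<alpha>)" "mdist (X_space \<alpha>)"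
    by (rule Metric_space_mspace_mdist)
  have top: "mtopology_of (X_space \<alpha>) = X.mtopology" by (simp add: mtopology_of_def)
  \<comment> \<open>Unions of balls rather than the set of all \<open>monotone_thin\<close> functions, so as to be open.\<close>
  define \<O> where "\<O> = (\<lambda>(\<sigma>, k :: nat, m, n). \<Union>{X.mball g \<delta> | g \<delta>.
      \<forall>h \<in> X.mball g \<delta>. monotone_thin \<sigma> \<alpha> (1 / real (Suc n)) k m h})"
  define P where "P = {1, -1 :: real} \<times> {2 :: nat..} \<times> (UNIV :: nat set) \<times> (UNIV :: nat set)"
  have cP: "countable P" unfolding P_def by (intro countable_SIGMA) auto
  have neP: "P \<noteq> {}" by (auto simp: P_def)
  have "openin X.mtopology T" and "X.mtopology closure_of T = mspace (X_space \<alpha>)"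
    if "T \<in> \<O> ` P" for T
  proof -
    obtain \<sigma> k m n where i: "(\<sigma>, k, m, n) \<in> P" and T: "T = \<O> (\<sigma>, k, m, n)"
      using \<open>T \<in> \<O> ` P\<close> by auto
    have ik: "\<sigma> \<in> {1, -1}" "2 \<le> k" using i by (auto simp: P_def)
    show "openin X.mtopology T" unfolding T \<O>_def by (auto intro!: openin_Union)
    show "X.mtopology closure_of T = mspace (X_space \<alpha>)"
    proof (rule antisym)
      show "mspace (X_space \<alpha>) \<subseteq> X.mtopology closure_of T"
      proof
        fix f assume f: "f \<in> mspace (X_space \<alpha>)"
        show "f \<in> X.mtopology closure_of T"
          unfolding X.metric_closure_of
        proof (intro CollectI conjI f allI impI)
          fix r :: real assume r: "0 < r"
          obtain g \<delta> where g: "g \<in> mspace (X_space \<alpha>)" "mdist (X_space \<alpha>) f g \<le> r / 2" "0 < \<delta>"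
            and thin: "\<And>h. h \<in> mspace (X_space \<alpha>) \<Longrightarrow> mdist (X_space \<alpha>) g h < \<delta> \<Longrightarrow>
                 monotone_thin \<sigma> \<alpha> (1 / real (Suc n)) k m h"
            using dense_monotone_thin_ball[OF assms ik(2) _ _ ik(1) f, of "1 / real (Suc n)" "r / 2" m] r
            by (metis divide_pos_pos half_gt_zero of_nat_0_less_iff zero_less_Suc zero_less_one)
          have "\<forall>h \<in> X.mball g \<delta>. monotone_thin \<sigma> \<alpha> (1 / real (Suc n)) k m h"
            using thin by (meson X.in_mball)
          then have "X.mball g \<delta> \<subseteq> T" unfolding T \<O>_def by blast
          then have "g \<in> T" using g by auto
          then show "\<exists>g\<in>T. g \<in> X.mball f r" using f g r by (intro bexI[of _ g]) auto
        qed
      qed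
    qed (use closure_of_subset_topspace[of X.mtopology T] in simp)
  qed
  note open_dense = this
  define \<G> where "\<G> = \<Inter>(\<O> ` P)"
  have gdelta: "gdelta_in X.mtopology \<G>"
    unfolding \<G>_def using cP neP open_dense(1)
    by (intro gdelta_in_Inter) (auto intro: open_imp_gdelta_in)
  have dense: "X.mtopology closure_of \<G> = mspace (X_space \<alpha>)"
    unfolding \<G>_def
    by (rule X.metric_Baire_category[OF mcomplete_X_space]) (use cP open_dense in auto)
  have "lower_minkowski_dim k A \<le> ereal \<alpha>"
    if f: "f \<in> \<G>" and A: "A \<subseteq> {0..1}" and mono: "mono_on A f \<or> antimono_on A f" and k: "2 \<le> k"
    for f A and k :: nat
  proof (rule lower_minkowski_dim_le[OF k assms(1)])
    fix n m
    obtain \<sigma> :: real where \<sigma>: "\<sigma> \<in> {1, -1}" "mono_on A (\<lambda>x. \<sigma> * f x)"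
    proof (cases "mono_on A f")
      case True
      then show ?thesis using that[of 1] by simp
    next
      case False
      then have "mono_on A (\<lambda>x. - 1 * f x)"
        using mono by (auto simp: monotone_on_def)
      then show ?thesis using that[of "-1"] by simp
    qed
    have "f \<in> \<O> (\<sigma>, k, m, n)" using f \<sigma> k by (auto simp: \<G>_def P_def)
    then have "monotone_thin \<sigma> \<alpha> (1 / real (Suc n)) k m f" by (auto simp: \<O>_def)
    then show "\<exists>l\<ge>m. real (grid_count k l A) \<le> (real k ^ l) powr (\<alpha> + 1 / real (Suc n))"
      using A \<sigma>(2) unfolding monotone_thin_def by blast
  qed
  then show ?thesis
    using gdelta dense hausdorff_dim_le_lower_minkowski_dim unfolding top by blast
qed

end
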